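(* Let $n\geq 1$ and let $M=(m_{ij})\in\mathbb{R}^{n\times n}$ be a nonnegative real matrix such that $m_{ii}>0$ for every $i$ with $1\leq i\leq n$. Then there is a positive vector $\mathbf{x}=(x_1,\dots,x_n)^t$ such that $M\mathbf{x}=\left(\frac{1}{x_1},\dots,\frac{1}{x_n}\right)^t$.
   Context: A vector or a matrix is nonnegative (resp. positive) if all of its entries are nonnegative (resp. positive). *)

theory Defs
  imports "HOL-Analysis.Analysis"
begin

end

theory Submission
  imports Defs
begin

text \<open>Row \<open>i\<close> of the equation reads \<open>m\<^sub>i\<^sub>i x\<^sub>i\<^sup>2 + s\<^sub>i x\<^sub>i = 1\<close>, where \<open>s\<^sub>i \<ge> 0\<close> collects the off-diagonal terms
  and does not depend on \<open>x\<^sub>i\<close>. Solving this quadratic for its positive root turns the equation into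
  a fixed point problem for a continuous map. The root is at most its value \<open>1/\<surd>m\<^sub>i\<^sub>i\<close> at \<open>s\<^sub>i = 0\<close>,
  so the map preserves a compact box and Brouwer's theorem applies.\<close>

text \<open>The root is written with the square root in the denominator, which makes its positivity
  and its monotonicity in \<open>s\<close> visible.\<close>

definition pos_root :: "real \<Rightarrow> real \<Rightarrow> real" where
  "pos_root m s = 2 / (s + sqrt (s\<^sup>2 + 4 * m))"

text \<open>\<open>sqrt (4 * m)\<close> is the denominator at \<open>s = 0\<close>, so this bound
  gives both positivity and \<open>pos_root_le\<close>.\<close>

lemma pos_root_denom_ge:
  assumes "m > 0" "s \<ge> 0"
  shows "sqrt (4 * m) \<le> s + sqrt (s\<^sup>2 + 4 * m)"
proof -
  have "sqrt (4 * m) \<le> sqrt (s\<^sup>2 + 4 * m)"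
    by simp
  with assms show ?thesis
    by linarith
qed

lemma pos_root_denom_pos:
  assumes "m > 0" "s \<ge> 0"
  shows "s + sqrt (s\<^sup>2 + 4 * m) > 0"
  using pos_root_denom_ge[OF assms] assms(1) by (meson less_le_trans mult_pos_pos real_sqrt_gt_zero zero_less_numeral)

lemma pos_root_pos:
  assumes "m > 0" "s \<ge> 0"
  shows "pos_root m s > 0"
  using pos_root_denom_pos[OF assms] by (simp add: pos_root_def)

lemma pos_root_le:
  assumes "m > 0" "s \<ge> 0"
  shows "pos_root m s \<le> pos_root m 0"
  using pos_root_denom_ge[OF assms] assms by (simp add: pos_root_def frac_le)

text \<open>With \<open>d = s + r\<close>, clearing denominators leaves
  \<open>4 * m + 2 * s * d = d\<^sup>2\<close>, that is
  \<open>r\<^sup>2 = s\<^sup>2 + 4 * m\<close>.\<close>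

lemma pos_root_eq:
  assumes "m > 0" "s \<ge> 0"
  shows "m * pos_root m s + s = 1 / pos_root m s"
proof -
  define r where "r = sqrt (s\<^sup>2 + 4 * m)"
  have "r\<^sup>2 = s\<^sup>2 + 4 * m"
    unfolding r_def using assms by (intro real_sqrt_pow2) (simp add: add_nonneg_nonneg)
  moreover have "s + r > 0"
    unfolding r_def by (rule pos_root_denom_pos[OF assms])
  ultimately show ?thesis
    unfolding pos_root_def r_def[symmetric]
    by (simp add: field_simps power2_eq_square)
qed

theorem proposition10:
  fixes M :: "real ^ 'n ^ 'n"
  assumes nonneg: "\<And>i j. M $ i $ j \<ge> 0"
    and diag_pos: "\<And>i. M $ i $ i > 0"
  shows "\<exists>x :: real ^ 'n. (\<forall>i. x $ i > 0) \<and> M *v x = (\<chi> i. 1 / x $ i)"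
proof -
  define s where "s i x = (\<Sum>j\<in>UNIV - {i}. M $ i $ j * x $ j)" for i and x :: "real ^ 'n"
  define T where "T x = (\<chi> i. pos_root (M $ i $ i) (s i x))" for x
  define B where "B = cbox 0 (\<chi> i. pos_root (M $ i $ i) 0)"
  have s_nonneg: "s i x \<ge> 0" if "x \<in> B" for i x
    using that nonneg by (auto simp: s_def B_def mem_box_cart intro!: sum_nonneg)
  have s_cont: "continuous_on B (s i)" for i
    unfolding s_def by (intro continuous_intros)
  \<comment> \<open>Brouwer's theorem asks for a nonempty set.\<close>
  have "0 \<in> B"
    using diag_pos by (simp add: B_def mem_box_cart pos_root_pos less_imp_le)
  moreover have "continuous_on B T"
    unfolding T_def pos_root_def
  proof (intro continuous_intros s_cont ballI)
    show "s i x + sqrt ((s i x)\<^sup>2 + 4 * M $ i $ i) \<noteq> 0" if "x \<in> B" for i x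
      using pos_root_denom_pos[OF diag_pos s_nonneg[OF that]] by (metis less_irrefl)
  qed
  moreover have "T \<in> B \<rightarrow> B"
  proof
    fix x assume x: "x \<in> B"
    show "T x \<in> B"
      using pos_root_pos[OF diag_pos s_nonneg[OF x]] pos_root_le[OF diag_pos s_nonneg[OF x]]
      by (simp add: T_def B_def mem_box_cart less_imp_le)
  qed
  moreover have "compact B" "convex B"
    by (simp_all add: B_def)
  ultimately obtain x where x: "x \<in> B" "T x = x"
    using brouwer[of B T] by blast
  have x_eq: "x $ i = pos_root (M $ i $ i) (s i x)" for i
    using arg_cong[OF x(2), of "\<lambda>y. y $ i"] by (simp add: T_def)
  have "(M *v x) $ i = 1 / x $ i" for i
  proof -
    have "(M *v x) $ i = M $ i $ i * x $ i + s i x"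
      by (simp add: matrix_vector_mult_def s_def sum.remove[of UNIV i])
    then show ?thesis
      using pos_root_eq[OF diag_pos s_nonneg[OF x(1)]] x_eq by metis
  qed
  \<comment> \<open>Membership in \<open>B\<close> gives only \<open>x $ i \<ge> 0\<close>;
    strictness holds because \<open>x\<close> is a value of \<open>T\<close>.\<close>
  moreover have "x $ i > 0" for i
    using pos_root_pos[OF diag_pos s_nonneg[OF x(1)]] x_eq by metis
  ultimately show ?thesis
    by (auto simp: vec_eq_iff)
qed

end
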